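(* Let $n\ge 1$, let $S\subseteq[n-1]$ and $T=S\cup\{n\}$. Then the feasible polytope $P(\Delta[S,T])\subseteq\mathbb{R}^n$ has a unimodular triangulation whose maximal simplices are in bijection with the permutations $w\in S_n$ whose ascent set $\{i\in[n-1]: w(i)<w(i+1)\}$ equals $S$.
   Context: Type $C_n$ Gale order on subsets of $[n]$: for $A=\{a_1<\dots<a_j\}$, $B=\{b_1<\dots<b_k\}$, $A\le B$ iff $j\le k$ and $a_{j-i+1}\le b_{k-i+1}$ for all $i\in[j]$. For $S\le T$, $\Delta[S,T]$ is the delta matroid on $[n]$ whose feasible sets are all $R\subseteq[n]$ with $S\le R\le T$, and $P(\Delta[S,T])=\operatorname{conv}\{e_R : R\text{ feasible}\}$ with $e_R=\sum_{i\in R}e_i$. A unimodular triangulation of an $n$-dimensional lattice polytope $P$ is a finite collection of $n$-dimensional simplices with vertices in $\mathbb{Z}^n$, each of volume $1/n!$, whose union is $P$ and such that any two intersect in a common face (possibly empty). *)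

theory Defs
  imports "HOL-Analysis.Analysis" "HOL-Combinatorics.Permutations"
begin

section \<open>Gale order and the delta matroids $\Delta[S,T]$\<close>

text \<open>
  For a finite \<open>A = {a\<^sub>1 < \<dots> < a\<^sub>j}\<close> and \<open>1 \<le> i \<le> j\<close>, \<open>nth_smallest A i\<close> is \<open>a\<^sub>i\<close>.
\<close>

definition nth_smallest :: "nat set \<Rightarrow> nat \<Rightarrow> nat" where
  "nth_smallest A i = sorted_list_of_set A ! (i - 1)"

definition gale_le :: "nat set \<Rightarrow> nat set \<Rightarrow> bool" where
  "gale_le A B \<longleftrightarrow> card A \<le> card B \<and>
     (\<forall>i\<in>{1..card A}. nth_smallest A (card A - i + 1) \<le> nth_smallest B (card B - i + 1))"

text \<open>The delta matroid \<open>\<Delta>[S,T]\<close> on \<open>{1..n}\<close> is represented by its family of feasible sets.\<close>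

definition Delta :: "nat \<Rightarrow> nat set \<Rightarrow> nat set \<Rightarrow> nat set set" where
  "Delta n S T = {R. R \<subseteq> {1..n} \<and> gale_le S R \<and> gale_le R T}"

section \<open>Feasible polytopes\<close>

text \<open>
  Euclidean $n$-space is \<open>real ^ 'n\<close> with \<open>CARD('n) = n\<close>. Since \<open>'n\<close> carries no order, a
  bijection \<open>coord\<close> from \<open>{1..n}\<close> to \<open>'n\<close> says which coordinate is the \<open>i\<close>-th one, so that
  the \<open>i\<close>-th standard basis vector is \<open>axis (coord i) 1\<close>.
\<close>

definition indicator_vec :: "(nat \<Rightarrow> 'n) \<Rightarrow> nat set \<Rightarrow> real ^ 'n::finite" where
  "indicator_vec coord R = (\<Sum>i\<in>R. axis (coord i) 1)"

definition feasible_polytope :: "(nat \<Rightarrow> 'n) \<Rightarrow> nat set set \<Rightarrow> (real ^ 'n::finite) set" where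
  "feasible_polytope coord \<F> = convex hull (indicator_vec coord ` \<F>)"

section \<open>Unimodular triangulations\<close>

definition integer_points :: "(real ^ 'n::finite) set" where
  "integer_points = {x. \<forall>i. x $ i \<in> \<int>}"

definition lattice_polytope :: "(real ^ 'n::finite) set \<Rightarrow> bool" where
  "lattice_polytope P \<longleftrightarrow> (\<exists>V. finite V \<and> V \<subseteq> integer_points \<and> P = convex hull V)"

text \<open>
  The family \<open>\<T>\<close> consists of the full-dimensional (maximal) simplices only. The library's
  \<open>triangulation\<close> provides finiteness and the condition that any two members meet in a
  common (possibly empty) face.
\<close>

definition unimodular_triangulation ::
  "(real ^ 'n::finite) set set \<Rightarrow> (real ^ 'n) set \<Rightarrow> bool" where
  "unimodular_triangulation \<T> P \<longleftrightarrow>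
     lattice_polytope P \<and> aff_dim P = int CARD('n) \<and>
     triangulation \<T> \<and>
     (\<forall>\<sigma>\<in>\<T>. int CARD('n) simplex \<sigma> \<and>
            {v. v extreme_point_of \<sigma>} \<subseteq> integer_points \<and>
            measure lebesgue \<sigma> = 1 / fact CARD('n)) \<and>
     \<Union>\<T> = P"

section \<open>Ascents\<close>

definition ascent_set :: "nat \<Rightarrow> (nat \<Rightarrow> nat) \<Rightarrow> nat set" where
  "ascent_set n w = {i \<in> {1..n - 1}. w i < w (i + 1)}"

end

theory Submission
  imports Defs
begin

text \<open>
  Write \<open>y\<^sub>i = (x\<^sub>i + \<dots> + x\<^sub>n) - |S \<inter> {i..n}|\<close>. This is a unimodular affine change of
  coordinates, and \<open>R\<close> is feasible iff all \<open>y\<^sub>i\<close> of its indicator vector are 0 or 1. The bounds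
  \<open>0 \<le> x\<^sub>i \<le> 1\<close> become \<open>y\<^sub>i \<le> y\<^sub>i\<^sub>+\<^sub>1\<close> for \<open>i \<in> S\<close> and \<open>y\<^sub>i \<ge> y\<^sub>i\<^sub>+\<^sub>1\<close> for
  \<open>i \<notin> S\<close>, so the feasible polytope is the order polytope of a zigzag poset. Its canonical
  triangulation has one simplex per linear extension, and these are the permutations with ascent
  set \<open>S\<close>.
\<close>

section \<open>The Gale order in terms of counting functions\<close>

text \<open>In the sorted list of \<open>A\<close>, the entries from the \<open>k\<close>-th largest
  element onwards number exactly \<open>k\<close>. So that element reaches \<open>i\<close>
  precisely when at least \<open>k\<close> elements do.\<close>

lemma le_kth_largest_iff:
  assumes "finite A" "k \<in> {1..card A}"
  shows "i \<le> nth_smallest A (card A - k + 1) \<longleftrightarrow> k \<le> card {a \<in> A. i \<le> a}"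
proof -
  define xs where "xs = sorted_list_of_set A"
  have len: "length xs = card A" and A: "set xs = A" and dist: "distinct xs" and srt: "sorted xs"
    using assms by (auto simp: xs_def)
  \<comment> \<open>The 0-based index of the \<open>k\<close>-th largest element, whose 1-based
    position is \<open>card A - k + 1\<close>.\<close>
  define m where "m = card A - k"
  have m: "m < length xs" and k: "length (drop m xs) = k" "length (drop (Suc m) xs) = k - 1"
    using assms len by (auto simp: m_def)
  have nth: "nth_smallest A (card A - k + 1) = xs ! m"
    by (simp add: nth_smallest_def xs_def m_def)
  have fin: "finite {a \<in> A. i \<le> a}"
    using assms by simp
  show ?thesis
    unfolding nth
  proof
    assume "i \<le> xs ! m"
    have "i \<le> a" if a: "a \<in> set (drop m xs)" for a
    proof -
      obtain j where j: "j < length xs - m" "a = xs ! (m + j)"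
        using a m by (auto simp: in_set_conv_nth)
      then have "xs ! m \<le> a"
        by (auto intro: sorted_nth_mono[OF srt])
      with \<open>i \<le> xs ! m\<close> show ?thesis
        by simp
    qed
    then have "set (drop m xs) \<subseteq> {a \<in> A. i \<le> a}"
      using A set_drop_subset[of m xs] by auto
    then have "card (set (drop m xs)) \<le> card {a \<in> A. i \<le> a}"
      by (rule card_mono[OF fin])
    then show "k \<le> card {a \<in> A. i \<le> a}"
      using distinct_card[OF distinct_drop[OF dist]] k by simp
  next
    assume le: "k \<le> card {a \<in> A. i \<le> a}"
    show "i \<le> xs ! m"
    proof (rule ccontr)
      assume less: "\<not> i \<le> xs ! m"
      \<comment> \<open>If the entry at \<open>m\<close> is below \<open>i\<close>, all elements
        that reach \<open>i\<close> come after it, where only \<open>k - 1\<close> entries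
        remain.\<close>
      have "a \<in> set (drop (Suc m) xs)" if a: "a \<in> A" "i \<le> a" for a
      proof -
        obtain j where j: "j < length xs" "a = xs ! j"
          using A a by (metis in_set_conv_nth)
        then have "m < j"
          using sorted_nth_mono[OF srt, of j m] m less a by (meson le_trans not_le)
        then have "drop (Suc m) xs ! (j - Suc m) = a" "j - Suc m < length (drop (Suc m) xs)"
          using j by simp_all
        then show ?thesis
          using nth_mem by blast
      qed
      then have "card {a \<in> A. i \<le> a} \<le> card (set (drop (Suc m) xs))"
        by (intro card_mono) auto
      also have "\<dots> \<le> k - 1"
        using k(2) card_length[of "drop (Suc m) xs"] by simp
      finally show False
        using le assms by auto
    qed
  qed
qed

text \<open>Replaces comparisons of sorted entries by comparisons of counts. The counts are tail
  sums of indicator vectors, so feasibility becomes a system of linear inequalities.\<close>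

lemma gale_le_iff_card:
  assumes "finite A" "finite B"
  shows "gale_le A B \<longleftrightarrow> (\<forall>i. card {a \<in> A. i \<le> a} \<le> card {b \<in> B. i \<le> b})"
proof
  assume AB: "gale_le A B"
  show "\<forall>i. card {a \<in> A. i \<le> a} \<le> card {b \<in> B. i \<le> b}"
  proof
    fix i
    \<comment> \<open>For this \<open>k\<close> the \<open>k\<close>-th largest element of
      \<open>A\<close> reaches \<open>i\<close>; the Gale order passes this on to the
      \<open>k\<close>-th largest element of \<open>B\<close>.\<close>
    define k where "k = card {a \<in> A. i \<le> a}"
    show "card {a \<in> A. i \<le> a} \<le> card {b \<in> B. i \<le> b}"
    proof (cases "k = 0")
      case False
      have "k \<le> card A"
        unfolding k_def using assms by (intro card_mono) auto
      with False have kA: "k \<in> {1..card A}"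
        by auto
      with AB have kB: "k \<in> {1..card B}"
        by (auto simp: gale_le_def)
      have "i \<le> nth_smallest A (card A - k + 1)"
        using le_kth_largest_iff[OF assms(1) kA] by (simp add: k_def)
      also have "\<dots> \<le> nth_smallest B (card B - k + 1)"
        using AB kA by (auto simp: gale_le_def)
      finally show ?thesis
        using le_kth_largest_iff[OF assms(2) kB] by (simp add: k_def)
    qed (simp add: k_def)
  qed
next
  assume le: "\<forall>i. card {a \<in> A. i \<le> a} \<le> card {b \<in> B. i \<le> b}"
  have card: "card A \<le> card B"
    using le[rule_format, of 0] by simp
  show "gale_le A B"
    unfolding gale_le_def
  proof (intro conjI ballI card)
    fix k
    assume kA: "k \<in> {1..card A}"
    with card have kB: "k \<in> {1..card B}"
      by auto
    show "nth_smallest A (card A - k + 1) \<le> nth_smallest B (card B - k + 1)"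
      using le_kth_largest_iff[OF assms(1) kA] le_kth_largest_iff[OF assms(2) kB] le
        order_trans by blast
  qed
qed

section \<open>Permutations and strict total orders\<close>

text \<open>Each index is sent to one plus the number of its predecessors under \<open>r\<close>.
  This produces the permutation that sorts the coordinates of a given point.\<close>

lemma ex_permutation_ranking:
  fixes r :: "nat \<Rightarrow> nat \<Rightarrow> bool"
  assumes irrefl: "\<And>i. \<not> r i i"
    and trans: "\<And>i j k. r i j \<Longrightarrow> r j k \<Longrightarrow> r i k"
    and total: "\<And>i j. i \<noteq> j \<Longrightarrow> r i j \<or> r j i"
  shows "\<exists>w. w permutes {1..n} \<and> (\<forall>i\<in>{1..n}. \<forall>j\<in>{1..n}. w i < w j \<longleftrightarrow> r i j)"
proof -
  define w where "w i = (if i \<in> {1..n} then Suc (card {j \<in> {1..n}. r j i}) else i)" for i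
  have mono: "w i < w j" if "i \<in> {1..n}" "j \<in> {1..n}" "r i j" for i j
  proof -
    have "{k \<in> {1..n}. r k i} \<subset> {k \<in> {1..n}. r k j}"
      using that irrefl trans by blast
    then have "card {k \<in> {1..n}. r k i} < card {k \<in> {1..n}. r k j}"
      by (intro psubset_card_mono) auto
    then show ?thesis
      using that by (simp add: w_def)
  qed
  have iff: "w i < w j \<longleftrightarrow> r i j" if "i \<in> {1..n}" "j \<in> {1..n}" for i j
    using mono that total by (metis less_irrefl less_not_sym)
  have inj: "inj_on w {1..n}"
    using mono total by (intro inj_onI) (metis less_irrefl)
  have sub: "w ` {1..n} \<subseteq> {1..n}"
  proof clarify
    fix i assume i: "i \<in> {1..n}"
    have "card {j \<in> {1..n}. r j i} < card {1..n}"
    proof (rule psubset_card_mono)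
      show "{j \<in> {1..n}. r j i} \<subset> {1..n}"
        using i irrefl by blast
    qed simp
    then show "w i \<in> {1..n}"
      using i by (simp add: w_def)
  qed
  have "bij_betw w {1..n} {1..n}"
    using endo_inj_surj[OF _ sub inj] inj by (simp add: bij_betw_def)
  then have "w permutes {1..n}"
    by (rule bij_imp_permutes) (simp only: w_def if_False)
  with iff show ?thesis
    by blast
qed

text \<open>A permutation is determined by the order it induces, since each value is its own rank.
  The conclusion in \<open>le\<close> is weak because closed chambers only provide weak
  inequalities; injectivity of \<open>v\<close> makes it strict.\<close>

lemma permutes_eq_if_order_le:
  fixes v w :: "nat \<Rightarrow> nat"
  assumes v: "v permutes {1..n}" and w: "w permutes {1..n}"
    and le: "\<And>i j. i \<in> {1..n} \<Longrightarrow> j \<in> {1..n} \<Longrightarrow> w i < w j \<Longrightarrow> v i \<le> v j"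
  shows "v = w"
proof -
  have rank: "card {j \<in> {1..n}. u j \<le> u i} = u i" if u: "u permutes {1..n}" and i: "i \<in> {1..n}"
    for u and i :: nat
  proof -
    have "u ` {j \<in> {1..n}. u j \<le> u i} = {1..u i}"
    proof safe
      fix k assume "k \<in> {1..u i}"
      moreover have "u i \<le> n"
        using permutes_in_image[OF u, of i] i by simp
      ultimately have "inv u k \<in> {1..n}" "u (inv u k) = k"
        using permutes_in_image[OF permutes_inv[OF u], of k] permutes_inverses[OF u] by auto
      then show "k \<in> u ` {j \<in> {1..n}. u j \<le> u i}"
        using \<open>k \<in> {1..u i}\<close> by (intro image_eqI[of _ _ "inv u k"]) auto
    next
      fix j assume j: "j \<in> {1..n}" "u j \<le> u i"
      then show "u j \<in> {1..u i}"
        using permutes_in_image[OF u, of j] by simp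
    qed
    moreover have "inj_on u {j \<in> {1..n}. u j \<le> u i}"
      using permutes_inj[OF u] inj_on_subset by blast
    ultimately show ?thesis
      using card_image by fastforce
  qed
  have less: "v i < v j" if "i \<in> {1..n}" "j \<in> {1..n}" "w i < w j" for i j
    using le[OF that] that(3) inj_eq[OF permutes_inj[OF v], of i j] by (cases "i = j") auto
  have iff: "v i \<le> v j \<longleftrightarrow> w i \<le> w j" if "i \<in> {1..n}" "j \<in> {1..n}" for i j
    using less[of j i] le[of i j] less[of i j] inj_eq[OF permutes_inj[OF w], of i j] that
    by (cases "w i" "w j" rule: linorder_cases) auto
  show ?thesis
  proof
    fix i
    show "v i = w i"
    proof (cases "i \<in> {1..n}")
      case True
      then have "{j \<in> {1..n}. v j \<le> v i} = {j \<in> {1..n}. w j \<le> w i}"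
        using iff by blast
      then show ?thesis
        using rank[OF v True] rank[OF w True] by simp
    next
      case False
      then show ?thesis
        using v w by (simp add: permutes_not_in)
    qed
  qed
qed

section \<open>Unimodular images of the standard simplex\<close>

lemma std_simplex_cart:
  "convex hull (insert 0 Basis) = {z :: real ^ 'n. (\<forall>a. 0 \<le> z $ a) \<and> (\<Sum>a\<in>UNIV. z $ a) \<le> 1}"
proof -
  have B: "(Basis :: (real ^ 'n) set) = range (\<lambda>a. axis a 1)"
    by (auto simp: Basis_vec_def)
  have "inj (\<lambda>a :: 'n. axis a (1 :: real))"
    by (auto simp: inj_def axis_eq_axis)
  then show ?thesis
    unfolding std_simplex by (simp add: B sum.reindex inner_axis)
qed

lemma det_integral:
  fixes A :: "real ^ 'n ^ 'n"
  assumes "\<And>i j. A $ i $ j \<in> \<int>"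
  shows "det A \<in> \<int>"
  unfolding det_def using assms by (intro Ints_sum Ints_mult Ints_prod Ints_of_int) auto

text \<open>Both matrices have integer entries, so the two determinants are integers with product
  1.\<close>

lemma abs_det_unimodular:
  fixes f g :: "real ^ 'n \<Rightarrow> real ^ 'n"
  assumes "linear f" "linear g" "\<And>x. g (f x) = x"
    and "f ` integer_points \<subseteq> integer_points" "g ` integer_points \<subseteq> integer_points"
  shows "\<bar>det (matrix f)\<bar> = 1"
proof -
  have axis: "axis a 1 \<in> (integer_points :: (real ^ 'n) set)" for a
    by (simp add: integer_points_def axis_def)
  have int: "det (matrix h) \<in> \<int>" if "h ` integer_points \<subseteq> integer_points"
    for h :: "real ^ 'n \<Rightarrow> real ^ 'n"
  proof (rule det_integral)
    fix i j
    have "h (axis j 1) \<in> integer_points"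
      using that axis by blast
    then show "matrix h $ i $ j \<in> \<int>"
      by (simp add: matrix_def integer_points_def)
  qed
  have "g \<circ> f = id"
    using assms by auto
  then have "det (matrix g) * det (matrix f) = 1"
    using matrix_compose[OF assms(1,2)] by (metis det_I det_mul matrix_id_mat_1)
  moreover obtain p q where "det (matrix g) = of_int p" "det (matrix f) = of_int q"
    using int assms by (meson Ints_cases)
  ultimately have "p * q = 1" and q: "det (matrix f) = of_int q"
    by (simp_all flip: of_int_mult)
  then have "\<bar>q\<bar> = 1"
    by (auto simp: zmult_eq_1_iff)
  then show ?thesis
    using q by (metis of_int_abs of_int_1)
qed

text \<open>The library proves this only for index types of class \<open>wellorder\<close>.\<close>

lemma linear_image_lmeasurable:
  fixes f :: "real ^ 'n \<Rightarrow> real ^ 'n"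
  assumes "linear f" "S \<in> lmeasurable"
  shows "f ` S \<in> lmeasurable"
    and "measure lebesgue (f ` S) = \<bar>det (matrix f)\<bar> * measure lebesgue S"
proof -
  let ?P = "\<lambda>f :: real ^ 'n \<Rightarrow> real ^ 'n. \<forall>S\<in>lmeasurable. f ` S \<in> lmeasurable \<and>
     measure lebesgue (f ` S) = \<bar>det (matrix f)\<bar> * measure lebesgue S"
  \<comment> \<open>Swaps and shears, like their inverses, preserve integer points, so their
    determinants have absolute value 1 and it remains to see that they preserve volumes of
    boxes.\<close>
  have unimodular: "?P h" if h: "linear h" "linear k" "\<And>x. k (h x) = x"
    "h ` integer_points \<subseteq> integer_points" "k ` integer_points \<subseteq> integer_points"
    and box: "\<And>a b. measure lebesgue (h ` cbox a b) = measure lebesgue (cbox a b)"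
    for h k :: "real ^ 'n \<Rightarrow> real ^ 'n"
  proof
    fix S :: "(real ^ 'n) set"
    assume S: "S \<in> lmeasurable"
    show "h ` S \<in> lmeasurable \<and> measure lebesgue (h ` S) = \<bar>det (matrix h)\<bar> * measure lebesgue S"
      using measure_linear_sufficient[OF h(1) S, of 1] box abs_det_unimodular[OF h] by force
  qed
  have "?P f"
  proof (rule induct_linear_elementary[OF assms(1)])
    fix f g :: "real ^ 'n \<Rightarrow> real ^ 'n"
    assume "linear f" "linear g" and f: "?P f" and g: "?P g"
    then have det: "\<bar>det (matrix (f \<circ> g))\<bar> = \<bar>det (matrix f)\<bar> * \<bar>det (matrix g)\<bar>"
      by (simp add: matrix_compose det_mul abs_mult)
    show "?P (f \<circ> g)"
      unfolding det image_comp[symmetric] mult.assoc using f g by metis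
  next
    fix f :: "real ^ 'n \<Rightarrow> real ^ 'n" and i
    assume f: "linear f" "\<And>x. f x $ i = 0"
    \<comment> \<open>A vanishing coordinate rules out surjectivity, so \<open>f\<close> is singular
      and both sides of the volume formula are 0.\<close>
    then have "\<not> inj f"
      using linear_injective_imp_surjective[OF f(1)] by (metis one_neq_zero surjD vec_component)
    then have "det (matrix f) = 0" "\<And>S. negligible (f ` S)"
      using det_nz_iff_inj[OF f(1)] negligible_linear_singular_image[OF f(1)] by auto
    then show "?P f"
      by (simp add: negligible_imp_measure0 negligible_imp_measurable)
  next
    fix c
    show "?P (\<lambda>x. \<chi> i. c i * x $ i)"
      by (simp add: measurable_stretch measure_stretch matrix_def det_diagonal axis_def)
  next
    fix p q :: 'n
    let ?h = "\<lambda>x :: real ^ 'n. \<chi> i. x $ Transposition.transpose p q i"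
    have lin: "linear ?h"
      by (rule linearI) (simp_all add: vec_eq_iff)
    show "?P ?h"
    proof (rule unimodular[OF lin lin])
      fix a b :: "real ^ 'n"
      have img: "?h ` cbox a b = cbox (?h a) (?h b)"
      proof (intro equalityI subsetI)
        fix x assume "x \<in> cbox (?h a) (?h b)"
        then have "?h x \<in> cbox a b"
          unfolding mem_box_cart by (metis transpose_involutory vec_lambda_beta)
        then show "x \<in> ?h ` cbox a b"
          by (intro image_eqI[of _ _ "?h x"]) (simp_all add: vec_eq_iff)
      qed (auto simp: mem_box_cart)
      have "(\<Prod>i\<in>UNIV. b $ Transposition.transpose p q i - a $ Transposition.transpose p q i) = (\<Prod>i\<in>UNIV. b $ i - a $ i)"
        using prod.permute[of "Transposition.transpose p q" UNIV "\<lambda>i. b $ i - a $ i"]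
        by (simp add: permutes_swap_id o_def)
      moreover have "cbox (?h a) (?h b) \<noteq> {}" if "cbox a b \<noteq> {}"
        using that img by blast
      ultimately show "measure lebesgue (?h ` cbox a b) = measure lebesgue (cbox a b)"
        unfolding img by (cases "cbox a b = {}") (use img in \<open>simp_all add: content_cbox_cart\<close>)
    qed (auto simp: integer_points_def)
  next
    fix p q :: 'n
    assume "p \<noteq> q"
    let ?h = "\<lambda>x :: real ^ 'n. \<chi> i. if i = p then x $ p + x $ q else x $ i"
    let ?k = "\<lambda>x :: real ^ 'n. \<chi> i. if i = p then x $ p - x $ q else x $ i"
    have lin: "linear ?h" "linear ?k"
      by (rule linearI; simp add: vec_eq_iff algebra_simps)+
    show "?P ?h"
    proof (rule unimodular[OF lin])
      fix a b :: "real ^ 'n"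
      \<comment> \<open>Translating by \<open>v\<close> moves the lower \<open>q\<close>-bound of
        the box to 0, as \<open>measure_shear_interval\<close> wants it nonnegative. The sheared box
        is then translated back by \<open>?h v\<close>.\<close>
      define v :: "real ^ 'n" where "v = axis q (- a $ q)"
      have "?h ` cbox a b = (+) (- ?h v) ` ?h ` (+) v ` cbox a b"
        unfolding image_image by (intro image_cong refl) (simp add: vec_eq_iff)
      then have "measure lebesgue (?h ` cbox a b) = measure lebesgue (?h ` cbox (v + a) (v + b))"
        by (simp only: measure_translation cbox_translation)
      also have "\<dots> = measure lebesgue (cbox (v + a) (v + b))"
      proof (cases "cbox (v + a) (v + b) = {}")
        case False
        then show ?thesis
          by (intro measure_shear_interval \<open>p \<noteq> q\<close>) (simp_all add: v_def)
      qed simp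
      also have "\<dots> = measure lebesgue (cbox a b)"
        unfolding cbox_translation by (rule measure_translation)
      finally show "measure lebesgue (?h ` cbox a b) = measure lebesgue (cbox a b)" .
    qed (use \<open>p \<noteq> q\<close> in \<open>auto simp: integer_points_def vec_eq_iff\<close>)
  qed
  with assms(2) show "f ` S \<in> lmeasurable"
    and "measure lebesgue (f ` S) = \<bar>det (matrix f)\<bar> * measure lebesgue S"
    by blast+
qed

text \<open>The vertices 0 and the unit vectors go to integer points. Injectivity of
  \<open>f\<close> keeps them affinely independent, and its determinant of absolute value 1 keeps
  the volume of the standard simplex.\<close>

lemma unimodular_image_std_simplex:
  fixes f g :: "real ^ 'n \<Rightarrow> real ^ 'n" and c :: "real ^ 'n"
  assumes f: "linear f" and g: "linear g" and gf: "\<And>x. g (f x) = x"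
    and fint: "f ` integer_points \<subseteq> integer_points" and gint: "g ` integer_points \<subseteq> integer_points"
    and c: "c \<in> integer_points"
    and \<sigma>: "\<sigma> = (\<lambda>z. c + f z) ` (convex hull (insert 0 Basis))"
  shows "int CARD('n) simplex \<sigma>" (is ?simplex)
    and "measure lebesgue \<sigma> = 1 / fact CARD('n)" (is ?measure)
    and "\<exists>C. finite C \<and> C \<subseteq> integer_points \<and> \<sigma> = convex hull C" (is ?lattice)
proof -
  define B :: "(real ^ 'n) set" where "B = insert 0 Basis"
  define C where "C = (+) c ` f ` B"
  have finB: "finite B" and cardB: "card B = Suc CARD('n)"
    by (simp_all add: B_def nonzero_Basis)
  have inj: "inj f"
    using gf by (metis injI)
  have \<sigma>': "\<sigma> = (+) c ` f ` (convex hull B)"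
    using \<sigma> by (simp add: image_image B_def)
  then have hull: "\<sigma> = convex hull C"
    using convex_hull_linear_image[OF f] by (simp add: C_def convex_hull_translation)
  have "\<not> affine_dependent B"
    unfolding B_def using independent_Basis affine_dependent_iff_dependent[of 0 "Basis :: (real ^ 'n) set"]
    by (simp add: nonzero_Basis image_def)
  then have indep: "\<not> affine_dependent C"
    using finB
    by (simp add: affine_independent_iff_card C_def aff_dim_translation_eq card_image
        aff_dim_injective_linear_image[OF f inj] inj_on_subset[OF inj])
  have "card C = Suc CARD('n)"
    by (simp add: C_def card_image inj_on_subset[OF inj] cardB)
  with indep hull show ?simplex
    unfolding simplex_def by (intro exI[of _ C]) simp
  have "B \<subseteq> integer_points"
    by (auto simp: B_def integer_points_def Basis_vec_def axis_def)
  then have "f ` B \<subseteq> integer_points"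
    using fint by blast
  then have "C \<subseteq> integer_points"
    using c by (auto simp: C_def integer_points_def image_subset_iff)
  with hull finB show ?lattice
    by (intro exI[of _ C]) (simp add: C_def)
  have "compact (convex hull B)"
    using finB by (simp add: compact_convex_hull finite_imp_compact)
  then have "convex hull B \<in> lmeasurable" "convex hull B \<in> sets borel"
    by (auto intro: lmeasurable_compact borel_closed compact_imp_closed)
  then have "measure lebesgue \<sigma> = measure lborel (convex hull B)"
    by (simp add: \<sigma>' measure_translation linear_image_lmeasurable(2)[OF f \<open>convex hull B \<in> lmeasurable\<close>]
        abs_det_unimodular[OF f g gf fint gint] measure_completion)
  then show ?measure
    by (simp add: B_def content_std_simplex)
qed

section \<open>The polytope in tail sum coordinates\<close>

text \<open>\<open>excess x i\<close> is the coordinate \<open>y\<^sub>i\<close> of the introduction.\<close>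

locale gale_interval =
  fixes n :: nat and S :: "nat set" and coord :: "nat \<Rightarrow> 'n::finite"
  assumes n: "n \<ge> 1"
    and coord: "bij_betw coord {1..n} (UNIV :: 'n set)"
    and S: "S \<subseteq> {1..n - 1}"
begin

definition tail_sum :: "real ^ 'n \<Rightarrow> nat \<Rightarrow> real" where
  "tail_sum x i = (\<Sum>j=i..n. x $ coord j)"

text \<open>The inverse of \<open>tail_sum\<close>; the value past \<open>n\<close> is taken to be
  0, the empty tail sum.\<close>

definition differences :: "(nat \<Rightarrow> real) \<Rightarrow> real ^ 'n" where
  "differences y = (\<chi> a. let i = inv_into {1..n} coord a in y i - (if i = n then 0 else y (i + 1)))"

definition excess :: "real ^ 'n \<Rightarrow> nat \<Rightarrow> real" where
  "excess x i = tail_sum (x - indicator_vec coord S) i"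

text \<open>The order polytope of the introduction, given by inequalities;
  \<open>feasible_polytope_eq\<close> identifies it with the feasible polytope.\<close>

definition order_region :: "(real ^ 'n) set" where
  "order_region =
     {x. \<forall>i\<in>{1..n}. 0 \<le> x $ coord i \<and> x $ coord i \<le> 1 \<and> 0 \<le> excess x i \<and> excess x i \<le> 1}"

text \<open>For a permutation, \<open>w i\<close> is the position of \<open>excess x i\<close> when
  these values are listed in weakly increasing order.\<close>

definition chamber :: "(nat \<Rightarrow> nat) \<Rightarrow> (real ^ 'n) set" where
  "chamber w =
     {x. (\<forall>i\<in>{1..n}. 0 \<le> excess x i \<and> excess x i \<le> 1) \<and>
         (\<forall>i\<in>{1..n}. \<forall>j\<in>{1..n}. w i < w j \<longrightarrow> excess x i \<le> excess x j)}"

lemma coord_eq_iff: "i \<in> {1..n} \<Longrightarrow> j \<in> {1..n} \<Longrightarrow> coord i = coord j \<longleftrightarrow> i = j"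
  by (rule inj_on_eq_iff[OF bij_betw_imp_inj_on[OF coord]])

lemma ex_coord: "\<exists>i\<in>{1..n}. a = coord i"
  using bij_betw_imp_surj_on[OF coord] by blast

lemma vec_eqI_coord:
  assumes "\<And>i. i \<in> {1..n} \<Longrightarrow> x $ coord i = y $ coord i"
  shows "x = (y :: 'a ^ 'n)"
  unfolding vec_eq_iff
proof
  fix a
  obtain i where "i \<in> {1..n}" "a = coord i"
    using ex_coord by blast
  then show "x $ a = y $ a"
    using assms by simp
qed

lemma sum_coord: "(\<Sum>a\<in>UNIV. f a) = (\<Sum>i=1..n. f (coord i))"
  by (rule sum.reindex_bij_betw[OF coord, symmetric])

lemma indicator_vec_coord:
  assumes "R \<subseteq> {1..n}" "i \<in> {1..n}"
  shows "indicator_vec coord R $ coord i = of_bool (i \<in> R)"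
proof -
  have fin: "finite R"
    using assms finite_subset by blast
  have "indicator_vec coord R $ coord i = (\<Sum>j\<in>R. if j = i then 1 else 0)"
    unfolding indicator_vec_def sum_component
    using assms coord_eq_iff by (intro sum.cong refl) (auto simp: axis_def subset_iff)
  also have "\<dots> = of_bool (i \<in> R)"
    using fin by simp
  finally show ?thesis .
qed

lemma S_subset: "S \<subseteq> {1..n}"
  by (rule order_trans[OF S]) auto

lemma integer_points_iff: "x \<in> integer_points \<longleftrightarrow> (\<forall>i\<in>{1..n}. x $ coord i \<in> \<int>)"
proof
  assume x: "\<forall>i\<in>{1..n}. x $ coord i \<in> \<int>"
  have "x $ a \<in> \<int>" for a
    using x ex_coord[of a] by auto
  then show "x \<in> integer_points"
    by (simp add: integer_points_def)
qed (simp add: integer_points_def)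

lemma indicator_vec_integer: "R \<subseteq> {1..n} \<Longrightarrow> indicator_vec coord R \<in> integer_points"
  by (simp add: integer_points_iff indicator_vec_coord)

lemma tail_sum_indicator:
  assumes "R \<subseteq> {1..n}" "i \<ge> 1"
  shows "tail_sum (indicator_vec coord R) i = card {j \<in> R. i \<le> j}"
proof -
  have "tail_sum (indicator_vec coord R) i = (\<Sum>j=i..n. of_bool (j \<in> R))"
    unfolding tail_sum_def using assms by (intro sum.cong refl indicator_vec_coord) auto
  also have "\<dots> = card ({i..n} \<inter> R)"
    by (simp add: of_bool_def sum.If_cases Int_def)
  also have "{i..n} \<inter> R = {j \<in> R. i \<le> j}"
    using assms by auto
  finally show ?thesis .
qed

lemma tail_sum_rec:
  "i \<in> {1..n} \<Longrightarrow> tail_sum x i = x $ coord i + (if i = n then 0 else tail_sum x (i + 1))"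
  unfolding tail_sum_def by (auto simp: sum.atLeast_Suc_atMost)

lemma tail_sum_linear:
  "tail_sum (x + y) i = tail_sum x i + tail_sum y i"
  "tail_sum (x - y) i = tail_sum x i - tail_sum y i"
  "tail_sum (r *\<^sub>R x) i = r * tail_sum x i"
  by (simp_all add: tail_sum_def sum.distrib sum_subtractf sum_distrib_left)

lemma differences_coord:
  "i \<in> {1..n} \<Longrightarrow> differences y $ coord i = y i - (if i = n then 0 else y (i + 1))"
  by (simp only: differences_def vec_lambda_beta bij_betw_inv_into_left[OF coord] Let_def)

lemma differences_tail_sum: "differences (tail_sum x) = x"
proof (rule vec_eqI_coord)
  fix i assume "i \<in> {1..n}"
  then show "differences (tail_sum x) $ coord i = x $ coord i"
    using tail_sum_rec[of i x] by (simp add: differences_coord)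
qed

lemma differences_cong:
  assumes "\<And>i. i \<in> {1..n} \<Longrightarrow> y i = z i"
  shows "differences y = differences z"
  by (rule vec_eqI_coord) (use assms in \<open>auto simp: differences_coord\<close>)

lemma tail_sum_differences:
  assumes "i \<in> {1..n}"
  shows "tail_sum (differences y) i = y i"
proof -
  have "i \<le> n" "1 \<le> i"
    using assms by auto
  then show ?thesis
  proof (induction i rule: inc_induct)
    case base
    then show ?case
      by (simp add: tail_sum_rec[of n] differences_coord)
  next
    case (step i)
    then show ?case
      by (simp add: tail_sum_rec[of i] differences_coord)
  qed
qed

text \<open>Consecutive tail sums differ by one coordinate. When all excess values lie in [0,1],
  this turns the cube bounds at \<open>i < n\<close> into a comparison of \<open>excess x i\<close>
  with \<open>excess x (i + 1)\<close>, whose direction depends on whether \<open>i\<close> is in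
  \<open>S\<close>.\<close>

lemma excess_rec:
  assumes "i \<in> {1..n}"
  shows "x $ coord i = excess x i - (if i = n then 0 else excess x (i + 1)) + of_bool (i \<in> S)"
  using tail_sum_rec[OF assms, of "x - indicator_vec coord S"] assms
  by (simp add: excess_def indicator_vec_coord[OF S_subset])

lemma ex_excess_eq: "\<exists>x. \<forall>i\<in>{1..n}. excess x i = y i"
  by (rule exI[of _ "indicator_vec coord S + differences y"])
    (simp add: excess_def tail_sum_differences)

text \<open>\<open>excess\<close> is affine with a constant term coming from \<open>S\<close>, hence
  the condition on the weights.\<close>

lemma excess_convex_comb:
  assumes "u + v = 1"
  shows "excess (u *\<^sub>R x + v *\<^sub>R y) i = u * excess x i + v * excess y i"
proof -
  have "u *\<^sub>R x + v *\<^sub>R y - indicator_vec coord S =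
    u *\<^sub>R (x - indicator_vec coord S) + v *\<^sub>R (y - indicator_vec coord S)"
    using assms by (simp add: algebra_simps flip: scaleR_left_distrib)
  then show ?thesis
    by (simp only: excess_def tail_sum_linear)
qed

subsection \<open>Feasible sets\<close>

text \<open>Feasibility bounds the counts of \<open>R\<close> by those of \<open>S\<close> and of
  \<open>S \<union> {n}\<close>. These bounds differ by exactly 1 at thresholds in
  \<open>{1..n}\<close>, and the excess is the count of \<open>R\<close> minus that of
  \<open>S\<close>.\<close>

lemma mem_Delta_iff:
  "R \<in> Delta n S (S \<union> {n}) \<longleftrightarrow>
     R \<subseteq> {1..n} \<and> (\<forall>i\<in>{1..n}. excess (indicator_vec coord R) i \<in> {0, 1})"
proof (cases "R \<subseteq> {1..n}")
  case True
  define c where "c A i = card {j \<in> A. i \<le> j}" for A :: "nat set" and i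
  have fin: "finite R" "finite S"
    using True S_subset finite_subset by blast+
  \<comment> \<open>The Gale criterion runs over all naturals, the excess only over
    \<open>{1..n}\<close>. Beyond \<open>n\<close> the counts vanish, and threshold 0 agrees with
    threshold 1.\<close>
  have beyond: "c R i = 0" "c S i = 0" if "i > n" for i
  proof -
    have "{j \<in> R. i \<le> j} = {}" "{j \<in> S. i \<le> j} = {}"
      using that True S_subset by fastforce+
    then show "c R i = 0" "c S i = 0"
      by (simp_all only: c_def card.empty)
  qed
  have zero: "c A 0 = c A 1" if "A \<subseteq> {1..n}" for A
    unfolding c_def using that by (intro arg_cong[of _ _ card]) force
  have cT: "c (S \<union> {n}) i = c S i + of_bool (i \<le> n)" for i
  proof -
    have "n \<notin> S"
      using S n by auto
    moreover have "{j \<in> S \<union> {n}. i \<le> j} = (if i \<le> n then insert n {j \<in> S. i \<le> j} else {j \<in> S. i \<le> j})"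
      by auto
    ultimately show ?thesis
      using fin by (simp add: c_def)
  qed
  have exc: "excess (indicator_vec coord R) i = real (c R i) - real (c S i)" if "i \<in> {1..n}" for i
    unfolding excess_def tail_sum_linear c_def
    using that by (simp add: tail_sum_indicator[OF True] tail_sum_indicator[OF S_subset])
  have "R \<in> Delta n S (S \<union> {n}) \<longleftrightarrow> (\<forall>i. c S i \<le> c R i \<and> c R i \<le> c S i + of_bool (i \<le> n))"
  proof -
    have "gale_le S R \<longleftrightarrow> (\<forall>i. c S i \<le> c R i)"
      "gale_le R (S \<union> {n}) \<longleftrightarrow> (\<forall>i. c R i \<le> c (S \<union> {n}) i)"
      using fin by (simp_all only: c_def gale_le_iff_card finite_Un finite.intros)
    then show ?thesis
      unfolding Delta_def cT using True by blast
  qed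
  also have "\<dots> \<longleftrightarrow> (\<forall>i\<in>{1..n}. c S i \<le> c R i \<and> c R i \<le> c S i + of_bool (i \<le> n))" (is "_ \<longleftrightarrow> ?B")
  proof (intro iffI allI)
    fix i
    assume B: ?B
    consider "i = 0" | "i \<in> {1..n}" | "i > n"
      by fastforce
    then show "c S i \<le> c R i \<and> c R i \<le> c S i + of_bool (i \<le> n)"
    proof cases
      case 1
      then show ?thesis
        using bspec[OF B, of 1] n by (simp only: zero[OF True] zero[OF S_subset]) simp
    qed (use B beyond in auto)
  qed blast
  also have "\<dots> \<longleftrightarrow> (\<forall>i\<in>{1..n}. excess (indicator_vec coord R) i \<in> {0, 1})"
  proof (intro ball_cong refl)
    fix i assume "i \<in> {1..n}"
    then show "c S i \<le> c R i \<and> c R i \<le> c S i + of_bool (i \<le> n) \<longleftrightarrow>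
      excess (indicator_vec coord R) i \<in> {0, 1}"
      by (auto simp: exc)
  qed
  finally show ?thesis
    using True by simp
qed (simp add: Delta_def)

lemma Ints_unit_interval: "(r :: real) \<in> \<int> \<Longrightarrow> 0 \<le> r \<Longrightarrow> r \<le> 1 \<Longrightarrow> r \<in> {0, 1}"
  by (auto elim!: Ints_cases)

lemma tail_sum_integer: "x \<in> integer_points \<Longrightarrow> tail_sum x i \<in> \<int>"
  unfolding tail_sum_def integer_points_def by (auto intro: Ints_sum)

lemma diff_integer_points: "x \<in> integer_points \<Longrightarrow> y \<in> integer_points \<Longrightarrow> x - y \<in> integer_points"
  by (simp add: integer_points_def)

text \<open>Integer points of the region have 0/1 coordinates and 0/1 excess values: the former
  makes them indicator vectors, the latter makes their sets feasible.\<close>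

lemma order_region_integer_points:
  "order_region \<inter> integer_points = indicator_vec coord ` Delta n S (S \<union> {n})"
proof (intro equalityI subsetI)
  fix x assume x: "x \<in> order_region \<inter> integer_points"
  define R where "R = {i \<in> {1..n}. x $ coord i = 1}"
  have "x = indicator_vec coord R"
  proof (rule vec_eqI_coord)
    fix i assume i: "i \<in> {1..n}"
    then have "x $ coord i \<in> {0, 1}"
      using x by (intro Ints_unit_interval) (auto simp: order_region_def integer_points_def)
    then show "x $ coord i = indicator_vec coord R $ coord i"
      using i by (subst indicator_vec_coord) (auto simp: R_def)
  qed
  moreover have "excess x i \<in> {0, 1}" if "i \<in> {1..n}" for i
    using that x S_subset unfolding excess_def
    by (intro Ints_unit_interval tail_sum_integer diff_integer_points indicator_vec_integer)
      (auto simp: order_region_def excess_def)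
  moreover have "R \<subseteq> {1..n}"
    by (auto simp: R_def)
  ultimately have "R \<in> Delta n S (S \<union> {n})"
    unfolding mem_Delta_iff by simp
  then show "x \<in> indicator_vec coord ` Delta n S (S \<union> {n})"
    using \<open>x = _\<close> by blast
next
  fix x assume "x \<in> indicator_vec coord ` Delta n S (S \<union> {n})"
  then obtain R where R: "x = indicator_vec coord R" "R \<subseteq> {1..n}"
    and "\<And>i. i \<in> {1..n} \<Longrightarrow> excess x i \<in> {0, 1}"
    unfolding mem_Delta_iff image_iff Bex_def by blast
  then show "x \<in> order_region \<inter> integer_points"
    by (fastforce simp: order_region_def indicator_vec_coord indicator_vec_integer)
qed

lemma convex_order_region: "convex order_region"
proof (rule convexI)
  fix x y :: "real ^ 'n" and u v :: real
  assume xy: "x \<in> order_region" "y \<in> order_region" and uv: "0 \<le> u" "0 \<le> v" "u + v = 1"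
  have "u * s + v * t \<in> {0..1}" if "s \<in> {0..1}" "t \<in> {0..1}" for s t :: real
    using that uv convexD[of "{0..1 :: real}" s t u v] by simp
  then show "u *\<^sub>R x + v *\<^sub>R y \<in> order_region"
    using xy by (simp add: order_region_def excess_convex_comb[OF uv(3)])
qed

subsection \<open>The chambers\<close>

lemma convex_chamber: "convex (chamber w)"
proof (rule convexI)
  fix x y :: "real ^ 'n" and u v :: real
  assume xy: "x \<in> chamber w" "y \<in> chamber w" and uv: "0 \<le> u" "0 \<le> v" "u + v = 1"
  have "u * s + v * t \<in> {0..1}" if "s \<in> {0..1}" "t \<in> {0..1}" for s t :: real
    using that uv convexD[of "{0..1 :: real}" s t u v] by simp
  moreover have "u * s + v * t \<le> u * s' + v * t'" if "s \<le> s'" "t \<le> t'" for s t s' t' :: real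
    using that uv by (intro add_mono mult_left_mono)
  ultimately show "u *\<^sub>R x + v *\<^sub>R y \<in> chamber w"
    using xy by (simp add: chamber_def excess_convex_comb[OF uv(3)])
qed

text \<open>
  A point of both chambers satisfies \<open>excess x i = excess x j\<close> for every pair \<open>i, j\<close> that the two
  permutations order differently, and such an equation spreads over any segment of the first
  chamber through the point.
\<close>

lemma chamber_Int_face:
  assumes "inj v"
  shows "(chamber v \<inter> chamber w) face_of chamber v"
  unfolding face_of_def
proof (intro conjI ballI impI)
  fix a b x
  assume a: "a \<in> chamber v" and b: "b \<in> chamber v" and x: "x \<in> chamber v \<inter> chamber w"
    and seg: "x \<in> open_segment a b"
  obtain u where u: "0 < u" "u < 1" and x_eq: "x = (1 - u) *\<^sub>R a + u *\<^sub>R b"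
    using seg by (auto simp: in_segment)
  have "excess a i \<le> excess a j \<and> excess b i \<le> excess b j"
    if ij: "i \<in> {1..n}" "j \<in> {1..n}" "w i < w j" for i j
  proof (cases "v i < v j")
    case True
    then show ?thesis
      using a b ij by (auto simp: chamber_def)
  next
    case False
    then have "v j < v i"
      using ij(3) inj_eq[OF assms, of i j] by (cases "i = j") auto
    then have ji: "excess a j \<le> excess a i" "excess b j \<le> excess b i"
      using a b ij by (auto simp: chamber_def)
    have "excess x i \<le> excess x j"
      using x ij by (auto simp: chamber_def)
    then have "(1 - u) * (excess a i - excess a j) + u * (excess b i - excess b j) \<le> 0"
      unfolding x_eq by (simp add: excess_convex_comb) (simp add: algebra_simps)
    moreover have "0 \<le> (1 - u) * (excess a i - excess a j)" "0 \<le> u * (excess b i - excess b j)"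
      using u ji by simp_all
    ultimately have "(1 - u) * (excess a i - excess a j) = 0" "u * (excess b i - excess b j) = 0"
      by linarith+
    then show ?thesis
      using u by simp
  qed
  then show "a \<in> chamber v \<inter> chamber w" "b \<in> chamber v \<inter> chamber w"
    using a b by (auto simp: chamber_def)
qed (auto intro: convex_Int convex_chamber)

section \<open>Chambers as unimodular images of the standard simplex\<close>

text \<open>The coordinates of \<open>z\<close> are gaps between successive tail sums in the order
  given by \<open>w\<close>, the first one measured from 0; partial sums of the gaps restore the
  tail sums.\<close>

definition chamber_map :: "(nat \<Rightarrow> nat) \<Rightarrow> real ^ 'n \<Rightarrow> real ^ 'n" where
  "chamber_map w z = differences (\<lambda>i. \<Sum>k=1..w i. z $ coord k)"

definition chamber_unmap :: "(nat \<Rightarrow> nat) \<Rightarrow> real ^ 'n \<Rightarrow> real ^ 'n" where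
  "chamber_unmap w x = (\<chi> a. let k = inv_into {1..n} coord a in
     tail_sum x (inv w k) - (if k = 1 then 0 else tail_sum x (inv w (k - 1))))"

lemma chamber_unmap_coord:
  "k \<in> {1..n} \<Longrightarrow> chamber_unmap w x $ coord k =
     tail_sum x (inv w k) - (if k = 1 then 0 else tail_sum x (inv w (k - 1)))"
  by (simp only: chamber_unmap_def vec_lambda_beta bij_betw_inv_into_left[OF coord] Let_def)

lemma linear_chamber_map: "linear (chamber_map w)"
  by (rule linearI; rule vec_eqI_coord)
    (simp_all add: chamber_map_def differences_coord sum.distrib sum_distrib_left right_diff_distrib)

lemma linear_chamber_unmap: "linear (chamber_unmap w)"
  by (rule linearI; rule vec_eqI_coord)
    (simp_all add: chamber_unmap_coord tail_sum_linear right_diff_distrib)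

lemma chamber_map_integer: "chamber_map w ` integer_points \<subseteq> integer_points"
proof clarify
  fix z :: "real ^ 'n"
  assume "z \<in> integer_points"
  then have "(\<Sum>k=1..m. z $ coord k) \<in> \<int>" for m
    by (auto simp: integer_points_def intro: Ints_sum)
  then show "chamber_map w z \<in> integer_points"
    by (simp add: integer_points_iff chamber_map_def differences_coord)
qed

lemma chamber_unmap_integer: "chamber_unmap w ` integer_points \<subseteq> integer_points"
proof clarify
  fix x :: "real ^ 'n"
  assume "x \<in> integer_points"
  then show "chamber_unmap w x \<in> integer_points"
    unfolding integer_points_iff[of "chamber_unmap w x"]
    by (simp add: chamber_unmap_coord tail_sum_integer)
qed

context
  fixes w :: "nat \<Rightarrow> nat"
  assumes w: "w permutes {1..n}"
begin

lemma w_mem: "i \<in> {1..n} \<Longrightarrow> w i \<in> {1..n}"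
  using permutes_in_image[OF w] by simp

lemma inv_w_mem: "k \<in> {1..n} \<Longrightarrow> inv w k \<in> {1..n}"
  using permutes_in_image[OF permutes_inv[OF w]] by simp

lemma w_inv_w: "w (inv w k) = k" and inv_w_w: "inv w (w i) = i"
  using permutes_inverses[OF w] by auto

lemma tail_sum_chamber_map:
  "i \<in> {1..n} \<Longrightarrow> tail_sum (chamber_map w z) i = (\<Sum>k=1..w i. z $ coord k)"
  by (simp add: chamber_map_def tail_sum_differences)

lemma chamber_unmap_map: "chamber_unmap w (chamber_map w z) = z"
proof (rule vec_eqI_coord)
  fix k assume k: "k \<in> {1..n}"
  have cumul: "tail_sum (chamber_map w z) (inv w l) = (\<Sum>k=1..l. z $ coord k)" if "l \<in> {1..n}" for l
    using that by (simp only: tail_sum_chamber_map inv_w_mem w_inv_w)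
  show "chamber_unmap w (chamber_map w z) $ coord k = z $ coord k"
  proof (cases "k = 1")
    case True
    then show ?thesis
      using k by (simp add: chamber_unmap_coord cumul)
  next
    case False
    with k obtain l where l: "k = Suc l" "l \<in> {1..n}" "Suc l \<in> {1..n}"
      by (cases k) auto
    then show ?thesis
      using chamber_unmap_coord[OF l(3), of w] cumul[OF l(2)] cumul[OF l(3)] by simp
  qed
qed

lemma sum_chamber_unmap:
  "m \<in> {1..n} \<Longrightarrow> (\<Sum>k=1..m. chamber_unmap w x $ coord k) = tail_sum x (inv w m)"
proof (induction m)
  case (Suc m)
  show ?case
  proof (cases "m = 0")
    case True
    then show ?thesis
      using Suc.prems by (simp add: chamber_unmap_coord)
  next
    case False
    with Suc show ?thesis
      by (simp add: chamber_unmap_coord)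
  qed
qed simp

lemma chamber_map_unmap: "chamber_map w (chamber_unmap w x) = x"
proof -
  have "differences (\<lambda>i. \<Sum>k=1..w i. chamber_unmap w x $ coord k) = differences (tail_sum x)"
    by (rule differences_cong) (simp only: sum_chamber_unmap w_mem inv_w_w)
  then show ?thesis
    by (simp add: chamber_map_def differences_tail_sum)
qed

text \<open>In gap coordinates, the first gap is the smallest excess, the later gaps are nonnegative
  by the chain of inequalities, and their total is the largest excess. So the chamber conditions
  become those of the standard simplex.\<close>

lemma chamber_eq_image:
  "chamber w = (\<lambda>z. indicator_vec coord S + chamber_map w z) ` (convex hull (insert 0 Basis))"
proof (intro equalityI subsetI)
  fix x assume x: "x \<in> chamber w"
  define z where "z = chamber_unmap w (x - indicator_vec coord S)"
  have "0 \<le> z $ coord k" if k: "k \<in> {1..n}" for k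
  proof (cases "k = 1")
    case True
    then show ?thesis
      using x inv_w_mem[OF k] k by (simp add: z_def chamber_unmap_coord chamber_def excess_def)
  next
    case False
    with k have k': "k - 1 \<in> {1..n}" "k - 1 < k"
      by auto
    then have "excess x (inv w (k - 1)) \<le> excess x (inv w k)"
      using x inv_w_mem[OF k] inv_w_mem[OF k'(1)] by (auto simp: chamber_def w_inv_w)
    then show ?thesis
      using k False by (simp add: z_def chamber_unmap_coord excess_def)
  qed
  then have "0 \<le> z $ a" for a
    using ex_coord by metis
  moreover have "(\<Sum>a\<in>UNIV. z $ a) \<le> 1"
    unfolding sum_coord z_def using n inv_w_mem[of n] x
    by (subst sum_chamber_unmap) (auto simp: chamber_def excess_def)
  moreover have "x = indicator_vec coord S + chamber_map w z"
    by (simp add: z_def chamber_map_unmap)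
  ultimately show "x \<in> (\<lambda>z. indicator_vec coord S + chamber_map w z) ` (convex hull (insert 0 Basis))"
    unfolding std_simplex_cart by blast
next
  fix x
  assume "x \<in> (\<lambda>z. indicator_vec coord S + chamber_map w z) ` (convex hull (insert 0 Basis))"
  then obtain z where z: "\<And>a. 0 \<le> z $ a" "(\<Sum>k=1..n. z $ coord k) \<le> 1"
    and x: "x = indicator_vec coord S + chamber_map w z"
    unfolding std_simplex_cart sum_coord by blast
  have mono: "(\<Sum>k=1..l. z $ coord k) \<le> (\<Sum>k=1..m. z $ coord k)" if "l \<le> m" for l m
    using that z(1) by (intro sum_mono2) auto
  have exc: "excess x i = (\<Sum>k=1..w i. z $ coord k)" if "i \<in> {1..n}" for i
    using that by (simp add: x excess_def tail_sum_chamber_map)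
  show "x \<in> chamber w"
    unfolding chamber_def mem_Collect_eq
  proof (intro conjI ballI impI)
    fix i assume i: "i \<in> {1..n}"
    show "0 \<le> excess x i"
      using z(1) by (simp add: exc[OF i] sum_nonneg)
    show "excess x i \<le> 1"
      using mono[of "w i" n] w_mem[OF i] z(2) by (simp add: exc[OF i])
  next
    fix i j assume "i \<in> {1..n}" "j \<in> {1..n}" "w i < w j"
    then show "excess x i \<le> excess x j"
      using mono[of "w i" "w j"] by (simp add: exc)
  qed
qed

lemmas chamber_unimodular =
  unimodular_image_std_simplex[OF linear_chamber_map linear_chamber_unmap chamber_unmap_map
    chamber_map_integer chamber_unmap_integer indicator_vec_integer[OF S_subset] chamber_eq_image]

text \<open>A point with pairwise distinct excess values, from which \<open>w\<close> can be read
  off; it serves to tell chambers apart.\<close>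

lemma ex_rank_point: "\<exists>x\<in>chamber w. \<forall>i\<in>{1..n}. excess x i = real (w i) / real n"
proof -
  obtain x where x: "\<forall>i\<in>{1..n}. excess x i = real (w i) / real n"
    using ex_excess_eq[of "\<lambda>i. real (w i) / real n"] by blast
  moreover have "x \<in> chamber w"
    using x w_mem n by (auto simp: chamber_def divide_right_mono)
  ultimately show ?thesis
    by blast
qed

text \<open>An ascent or descent of \<open>w\<close> at \<open>i\<close> orders the neighbouring
  excess values in just the way that \<open>excess_rec\<close> translates into the cube
  bounds.\<close>

lemma chamber_subset_order_region:
  assumes "ascent_set n w = S"
  shows "chamber w \<subseteq> order_region"
proof
  fix x assume x: "x \<in> chamber w"
  have "0 \<le> x $ coord i \<and> x $ coord i \<le> 1" if i: "i \<in> {1..n}" for i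
  proof (cases "i = n")
    case True
    \<comment> \<open>The last coordinate has no successor and no correction from \<open>S\<close>,
      so it equals its excess.\<close>
    moreover have "n \<notin> S"
      using S n by auto
    ultimately show ?thesis
      using x i excess_rec[OF i, of x] by (simp add: chamber_def)
  next
    case False
    then have i': "i + 1 \<in> {1..n}" "i \<in> {1..n - 1}"
      using i by auto
    have bnd: "excess x j \<in> {0..1}" if "j \<in> {1..n}" for j
      using x that by (auto simp: chamber_def)
    show ?thesis
    proof (cases "i \<in> S")
      case True
      then have "w i < w (i + 1)"
        using assms by (auto simp: ascent_set_def)
      then have "excess x i \<le> excess x (i + 1)"
        using x i i' by (auto simp: chamber_def)
      then show ?thesis
        using bnd[OF i] bnd[OF i'(1)] True \<open>i \<noteq> n\<close> by (simp add: excess_rec[OF i, of x])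
    next
      case nS: False
      then have "\<not> w i < w (i + 1)"
        using assms i' by (auto simp: ascent_set_def)
      then have "w (i + 1) < w i"
        using inj_eq[OF permutes_inj[OF w], of i "i + 1"] by auto
      then have "excess x (i + 1) \<le> excess x i"
        using x i i' by (auto simp: chamber_def)
      then show ?thesis
        using bnd[OF i] bnd[OF i'(1)] nS \<open>i \<noteq> n\<close> by (simp add: excess_rec[OF i, of x])
    qed
  qed
  then show "x \<in> order_region"
    using x by (auto simp: order_region_def chamber_def)
qed

end

section \<open>The triangulation by chambers with ascent set \<open>S\<close>\<close>

lemma chamber_inject:
  assumes v: "v permutes {1..n}" and w: "w permutes {1..n}" and eq: "chamber v = chamber w"
  shows "v = w"
proof (rule permutes_eq_if_order_le[OF v w])
  fix i j assume ij: "i \<in> {1..n}" "j \<in> {1..n}" "w i < w j"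
  obtain x where x: "x \<in> chamber v" "\<forall>i\<in>{1..n}. excess x i = real (v i) / real n"
    using ex_rank_point[OF v] by blast
  then have "x \<in> chamber w"
    using eq by simp
  then have "excess x i \<le> excess x j"
    using ij by (simp add: chamber_def)
  then have "real (v i) / real n \<le> real (v j) / real n"
    using x(2) ij by simp
  then show "v i \<le> v j"
    using n by (simp add: divide_le_cancel)
qed

definition perms :: "(nat \<Rightarrow> nat) set" where
  "perms = {w. w permutes {1..n} \<and> ascent_set n w = S}"

text \<open>
  Ties among the coordinates \<open>excess x i\<close> are broken by a height function that goes up at the
  elements of \<open>S\<close> and down elsewhere, so that the ranking permutation has ascent set \<open>S\<close>.
\<close>

lemma Union_chambers: "(\<Union>w\<in>perms. chamber w) = order_region"
proof (intro equalityI subsetI)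
  fix x assume x: "x \<in> order_region"
  define h where "h i = 2 * int (card (S \<inter> {..<i})) - int i" for i
  \<comment> \<open>Distinct indices can share a height, so the index decides last to make
    \<open>r\<close> total. Neighbours never reach that clause, as their heights differ by
    1.\<close>
  define r where "r i j \<longleftrightarrow> excess x i < excess x j \<or>
    excess x i = excess x j \<and> (h i < h j \<or> h i = h j \<and> i < j)" for i j
  have h_Suc: "h (i + 1) = h i + (if i \<in> S then 1 else - 1)" for i
  proof -
    have "S \<inter> {..<i + 1} = (if i \<in> S then insert i (S \<inter> {..<i}) else S \<inter> {..<i})"
      by (auto simp: less_Suc_eq)
    then show ?thesis
      by (simp add: h_def)
  qed
  have "\<exists>w. w permutes {1..n} \<and> (\<forall>i\<in>{1..n}. \<forall>j\<in>{1..n}. w i < w j \<longleftrightarrow> r i j)"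
    by (rule ex_permutation_ranking) (auto simp: r_def)
  then obtain w where w: "w permutes {1..n}"
    and less: "\<And>i j. i \<in> {1..n} \<Longrightarrow> j \<in> {1..n} \<Longrightarrow> w i < w j \<longleftrightarrow> r i j"
    by blast
  have "w i < w (i + 1) \<longleftrightarrow> i \<in> S" if i: "i \<in> {1..n - 1}" for i
  proof -
    have i': "i \<in> {1..n}" "i + 1 \<in> {1..n}" "i \<noteq> n"
      using i by auto
    have "0 \<le> x $ coord i" "x $ coord i \<le> 1"
      using x i' by (auto simp: order_region_def)
    \<comment> \<open>The cube bounds give the right direction weakly; in case of equality the
      heights decide in the same direction.\<close>
    then have "if i \<in> S then excess x i \<le> excess x (i + 1) else excess x (i + 1) \<le> excess x i"
      using excess_rec[OF i'(1), of x] i'(3) by (auto split: if_splits)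
    then show ?thesis
      unfolding less[OF i'(1,2)] r_def h_Suc by (auto split: if_splits)
  qed
  then have "w \<in> perms"
    using w S by (auto simp: perms_def ascent_set_def)
  moreover have "x \<in> chamber w"
    using x less by (auto simp: chamber_def order_region_def r_def)
  ultimately show "x \<in> (\<Union>w\<in>perms. chamber w)"
    by blast
qed (use chamber_subset_order_region in \<open>auto simp: perms_def\<close>)

text \<open>Integrality of the region comes from the chambers: each point lies in one, whose
  vertices are integer points of the region and hence indicator vectors of feasible sets.\<close>

lemma feasible_polytope_eq: "feasible_polytope coord (Delta n S (S \<union> {n})) = order_region"
proof
  show "feasible_polytope coord (Delta n S (S \<union> {n})) \<subseteq> order_region"
    unfolding feasible_polytope_def order_region_integer_points[symmetric]
    by (rule hull_minimal[where S = convex]) (simp_all add: convex_order_region)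
  show "order_region \<subseteq> feasible_polytope coord (Delta n S (S \<union> {n}))"
  proof
    fix x assume "x \<in> order_region"
    then obtain w where w: "w \<in> perms" and x: "x \<in> chamber w"
      unfolding Union_chambers[symmetric] by blast
    then have perm: "w permutes {1..n}"
      by (simp add: perms_def)
    obtain C where C: "C \<subseteq> integer_points" "chamber w = convex hull C"
      using chamber_unimodular(3)[OF perm] by blast
    then have "C \<subseteq> order_region"
      using w hull_subset[of C convex] by (auto simp flip: Union_chambers)
    then have "convex hull C \<subseteq> convex hull (indicator_vec coord ` Delta n S (S \<union> {n}))"
      unfolding order_region_integer_points[symmetric] using C(1) by (intro hull_mono) simp
    then show "x \<in> feasible_polytope coord (Delta n S (S \<union> {n}))"
      using x C(2) by (auto simp: feasible_polytope_def)
  qed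
qed

lemma unimodular_triangulation_chambers:
  "unimodular_triangulation (chamber ` perms) (feasible_polytope coord (Delta n S (S \<union> {n})))"
proof -
  let ?P = "feasible_polytope coord (Delta n S (S \<union> {n}))"
  have perm: "w permutes {1..n}" if "w \<in> perms" for w
    using that by (simp add: perms_def)
  have "finite perms"
    using finite_permutations[of "{1..n}"] by (rule rev_finite_subset) (auto simp: perms_def)
  have simp: "int CARD('n) simplex chamber w" if "w \<in> perms" for w
    using chamber_unimodular(1)[OF perm[OF that]] .
  have "Delta n S (S \<union> {n}) \<subseteq> Pow {1..n}"
    by (auto simp: Delta_def)
  then have "finite (indicator_vec coord ` Delta n S (S \<union> {n}))"
    using finite_subset by blast
  then have lattice: "lattice_polytope ?P"
    unfolding lattice_polytope_def feasible_polytope_def order_region_integer_points[symmetric]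
    by blast
  \<comment> \<open>This point has excess 0 throughout. It shows that at least one chamber exists,
    and a chamber is a full-dimensional simplex, which fixes the dimension of the polytope.\<close>
  have "indicator_vec coord S \<in> order_region"
    by (auto simp: order_region_def excess_def tail_sum_def indicator_vec_coord[OF S_subset])
  then obtain w where w: "w \<in> perms"
    unfolding Union_chambers[symmetric] by blast
  have "int CARD('n) = aff_dim (chamber w)"
    using aff_dim_simplex[OF simp[OF w]] by simp
  also have "\<dots> \<le> aff_dim ?P"
    unfolding feasible_polytope_eq Union_chambers[symmetric] using w by (intro aff_dim_subset) blast
  finally have dim: "aff_dim ?P = int CARD('n)"
    using aff_dim_le_DIM[of ?P] by simp
  have "triangulation (chamber ` perms)"
    unfolding triangulation_def
  proof (intro conjI ballI allI impI)
    show "finite (chamber ` perms)"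
      using \<open>finite perms\<close> by simp
    show "\<exists>m. m simplex \<sigma>" if "\<sigma> \<in> chamber ` perms" for \<sigma>
      using that simp by blast
    fix \<sigma> \<tau> assume "\<sigma> \<in> chamber ` perms \<and> \<tau> \<in> chamber ` perms"
    then obtain v w where "v \<in> perms" "\<sigma> = chamber v" "\<tau> = chamber w"
      by blast
    then show "\<sigma> \<inter> \<tau> face_of \<sigma>"
      by (simp add: chamber_Int_face permutes_inj[OF perm])
  qed
  moreover have "{v. v extreme_point_of chamber w} \<subseteq> integer_points" if w: "w \<in> perms" for w
  proof -
    obtain C where "C \<subseteq> integer_points" "chamber w = convex hull C"
      using chamber_unimodular(3)[OF perm[OF w]] by blast
    then show ?thesis
      using extreme_point_of_convex_hull by auto
  qed
  moreover have "measure lebesgue (chamber w) = 1 / fact CARD('n)" if "w \<in> perms" for w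
    using chamber_unimodular(2)[OF perm[OF that]] .
  ultimately show ?thesis
    unfolding unimodular_triangulation_def
    using lattice dim simp Union_chambers[folded feasible_polytope_eq] by simp
qed

lemma bij_betw_chamber: "bij_betw chamber perms (chamber ` perms)"
  by (auto simp: bij_betw_def inj_on_def perms_def intro: chamber_inject)

end

theorem theorem5p9:
  fixes n :: nat and S :: "nat set" and coord :: "nat \<Rightarrow> 'n::finite"
  assumes "n \<ge> 1"
    and "bij_betw coord {1..n} (UNIV :: 'n set)"
    and "S \<subseteq> {1..n - 1}"
  shows "\<exists>\<T> :: (real ^ 'n) set set.
           unimodular_triangulation \<T> (feasible_polytope coord (Delta n S (S \<union> {n}))) \<and>
           (\<exists>f. bij_betw f \<T> {w. w permutes {1..n} \<and> ascent_set n w = S})"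
proof -
  interpret gale_interval n S coord
    using assms by unfold_locales
  show ?thesis
    unfolding perms_def[symmetric]
    using unimodular_triangulation_chambers bij_betw_inv_into[OF bij_betw_chamber] by blast
qed

end
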